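(* Let $q=p^m$ with $p$ an odd prime and $m\in\mathbb{N}$, and let $k\in\mathbb{N}$ with $k\mid q-1$. The graph $\Gamma(k,q)$ is undirected if and only if $v_2(k)<v_2(q-1)$ or $v_2(k)=0$. Equivalently, $\Gamma(k,q)$ is directed if and only if $v_2(k)=v_2(q-1)>0$. In this case, $k$ is even, $\Gamma(\tfrac k2,q)$ is undirected, the arc set of $\Gamma(\tfrac k2,q)$ is the union of the arc set of $\Gamma(k,q)$ and the arc set of $\Gamma(k,q)$ with all arcs reversed (equivalently $R_{k/2}=R_k\cup(-R_k)$, a disjoint union), and $$Spec(\Gamma(\tfrac k2,q)) = \{2\,\mathrm{Re}(\lambda) : \lambda\in Spec(\Gamma(k,q))\}$$ as multisets.
   Context: For $k\in\mathbb{N}$ let $R_k=\{x^k : x\in\mathbb{F}_q^*\}$. The generalized Paley graph $\Gamma(k,q)$ has vertex set $\mathbb{F}_q$ and an arc $x\to y$ iff $y-x\in R_k$; it is undirected if $R_k=-R_k$ and directed otherwise. $Spec$ denotes the multiset of adjacency eigenvalues. $v_2(n)$ is the $2$-adic valuation of $n$ ($v_2(n)=t$ iff $n=2^t u$ with $u$ odd). *)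

theory Defs
  imports
    "HOL-Analysis.Analysis"
    "HOL-Computational_Algebra.Computational_Algebra"
    "Graph_Theory.Pair_Digraph"
begin

definition power_set :: "nat \<Rightarrow> 'a::field set" where
  "power_set k = (\<lambda>x. x ^ k) ` (UNIV - {0})"

definition gen_paley :: "nat \<Rightarrow> 'a::field pair_pre_digraph" where
  "gen_paley k = \<lparr>pverts = UNIV, parcs = {(x, y). y - x \<in> power_set k}\<rparr>"

text \<open>
  The field is the type argument, passed as \<open>TYPE('a)\<close>. The lemma \<open>gp_undirected_iff_symmetric\<close>
  relates this condition on connection sets to symmetry of the digraph.
\<close>

definition gp_undirected :: "'a::field itself \<Rightarrow> nat \<Rightarrow> bool" where
  "gp_undirected _ k \<longleftrightarrow> (power_set k :: 'a set) = uminus ` power_set k"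

abbreviation gp_directed :: "'a::field itself \<Rightarrow> nat \<Rightarrow> bool" where
  "gp_directed F k \<equiv> \<not> gp_undirected F k"

lemma gp_undirected_iff_symmetric:
  "gp_undirected TYPE('a::field) k \<longleftrightarrow> symmetric (with_proj (gen_paley k :: 'a pair_pre_digraph))"
proof
  assume u: "gp_undirected TYPE('a) k"
  have neg: "- d \<in> power_set k" if "d \<in> power_set k" for d :: 'a
    using u that unfolding gp_undirected_def by auto
  show "symmetric (with_proj (gen_paley k :: 'a pair_pre_digraph))"
    unfolding symmetric_def sym_def by (auto simp: gen_paley_def dest: neg)
next
  assume s: "symmetric (with_proj (gen_paley k :: 'a pair_pre_digraph))"
  have neg: "- d \<in> power_set k" if "d \<in> power_set k" for d :: 'a
  proof -
    have "(0, d) \<in> parcs (gen_paley k)" using that by (simp add: gen_paley_def)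
    then have "(d, 0) \<in> parcs (gen_paley k)"
      using s by (auto simp: symmetric_def sym_def)
    then show ?thesis by (simp add: gen_paley_def)
  qed
  have "d \<in> uminus ` power_set k" if "d \<in> power_set k" for d :: 'a
    using neg[OF that] by (intro image_eqI[of _ _ "- d"]) auto
  then show "gp_undirected TYPE('a) k"
    unfolding gp_undirected_def using neg by blast
qed

text \<open>
  Rows and columns are indexed by the whole vertex type, so this is the adjacency matrix of
  a digraph \<open>G\<close> only if \<open>pverts G = UNIV\<close>, as is the case for \<^const>\<open>gen_paley\<close>.
\<close>

definition adjacency_matrix :: "'a::finite pair_pre_digraph \<Rightarrow> complex ^ 'a ^ 'a" where
  "adjacency_matrix G = (\<chi> x y. if (x, y) \<in> parcs G then 1 else 0)"

definition charpoly :: "'a::comm_ring_1 ^ 'n ^ 'n \<Rightarrow> 'a poly" where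
  "charpoly A = det (mat [:0, 1:] - (\<chi> i j. [:A $ i $ j:]))"

text \<open>Eigenvalues are counted with algebraic multiplicity.\<close>

definition Spec :: "'a::finite pair_pre_digraph \<Rightarrow> complex multiset" where
  "Spec G = proots (charpoly (adjacency_matrix G))"

end

theory Submission
  imports Defs "HOL-Number_Theory.Residues"
begin

text \<open>
  The connection set \<open>R\<^sub>k\<close> is a subgroup of the multiplicative group, so the graph is undirected
  iff \<open>-1 = x ^ k\<close> has a solution, which happens iff \<open>(q - 1) / k\<close> is even. When this quotient
  \<open>n\<close> is odd, \<open>(x ^ (k / 2)) ^ n\<close> is \<open>1\<close> or \<open>-1\<close>, and dividing by an even power of \<open>x ^ (k / 2)\<close>
  yields \<open>R\<^bsub>k/2\<^esub> = R\<^sub>k \<union> -R\<^sub>k\<close>.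

  For the spectra, fix a nontrivial additive character \<open>\<psi>\<close> of the field. The vectors
  \<open>x \<mapsto> \<psi> (a x)\<close> form an orthogonal eigenbasis of every Cayley graph of the additive group; the
  eigenvalue for connection set \<open>R\<close> is \<open>\<Sum>r\<in>R. \<psi> (a r)\<close>. Since \<open>\<psi> (-x)\<close> is the conjugate of
  \<open>\<psi> x\<close>, passing from \<open>R\<^sub>k\<close> to \<open>R\<^sub>k \<union> -R\<^sub>k\<close> replaces each eigenvalue by twice its real part.
\<close>

section \<open>Powers in finite fields\<close>

text \<open>Multiplication by \<open>x\<close> permutes the nonzero elements, so their product is
  unchanged when every factor picks up an \<open>x\<close>.\<close>

lemma field_power_card_minus_1:
  fixes x :: "'a::{field,finite}"
  assumes "x \<noteq> 0"
  shows "x ^ (CARD('a) - 1) = 1"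
proof -
  have "(\<Prod>y\<in>UNIV-{0}. x * y) = (\<Prod>y\<in>UNIV-{0}. y)"
    by (rule prod.reindex_bij_witness[of _ "\<lambda>y. y / x" "\<lambda>y. x * y"]) (use assms in auto)
  then have "x ^ (CARD('a) - 1) * \<Prod>(UNIV-{0::'a}) = \<Prod>(UNIV-{0::'a})"
    by (simp add: prod.distrib)
  moreover have "\<Prod>(UNIV-{0::'a}) \<noteq> 0"
    by simp
  ultimately show ?thesis
    by simp
qed

text \<open>
  If \<open>2k\<close> divides \<open>q - 1\<close>, then \<open>X\<^sup>k + 1\<close> divides \<open>X\<^bsup>q-1\<^esup> - 1\<close>, and the cofactor has too small a
  degree to vanish at all nonzero elements. This avoids cyclicity of the multiplicative group.
\<close>

lemma minus_one_is_power:
  assumes "0 < k" "2 * k dvd CARD('a::{field,finite}) - 1"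
  shows "\<exists>x::'a. x \<noteq> 0 \<and> x ^ k = - 1"
proof (rule ccontr)
  assume no_root: "\<not> ?thesis"
  obtain j where j: "CARD('a) - 1 = 2 * k * j"
    using assms(2) by (auto elim: dvdE)
  have "CARD('a) \<noteq> 1"
  proof
    assume "CARD('a) = 1"
    then obtain a :: 'a where "(UNIV :: 'a set) = {a}"
      by (auto simp: card_1_singleton_iff)
    then show False
      by (metis UNIV_I singletonD zero_neq_one)
  qed
  moreover have "CARD('a) > 0"
    by (simp add: card_gt_0_iff)
  ultimately have gt1: "CARD('a) > 1"
    by linarith
  then have "j > 0"
    using j by (cases j) auto
  define X where "X = (Polynomial.monom 1 k :: 'a poly)"
  \<comment> \<open>The cofactor of \<open>X + 1\<close> in \<open>X ^ (2 * j) - 1\<close>, where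
    \<open>X\<close> stands for the \<open>k\<close>-th power of the indeterminate.\<close>
  define g where "g = (X - 1) * (\<Sum>i<j. (X\<^sup>2) ^ i)"
  have poly_X: "poly X x = x ^ k" for x
    by (simp add: X_def poly_monom)
  have fac: "(X + 1) * g = Polynomial.monom 1 (CARD('a) - 1) - 1"
  proof -
    have "(X + 1) * g = (X\<^sup>2 - 1) * (\<Sum>i<j. (X\<^sup>2) ^ i)"
      by (simp add: g_def algebra_simps power2_eq_square)
    also have "\<dots> = (X\<^sup>2) ^ j - 1"
      by (rule power_diff_1_eq [symmetric])
    also have "(X\<^sup>2) ^ j = Polynomial.monom 1 (CARD('a) - 1)"
      unfolding j by (simp add: X_def monom_power mult_ac flip: power_mult)
    finally show ?thesis .
  qed
  have deg_rhs: "Polynomial.degree (Polynomial.monom (1::'a) (CARD('a) - 1) - 1) = CARD('a) - 1"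
    using gt1 unfolding diff_conv_add_uminus by (subst degree_add_eq_left) (auto simp: degree_monom_eq)
  have deg_X1: "Polynomial.degree (X + 1) = k"
    using \<open>0 < k\<close> by (subst degree_add_eq_left) (auto simp: X_def degree_monom_eq)
  have nz: "X + 1 \<noteq> 0" "g \<noteq> 0"
    using deg_rhs fac gt1 by force+
  have deg_g: "k + Polynomial.degree g = CARD('a) - 1"
    using degree_mult_eq [OF nz] unfolding fac deg_rhs deg_X1 by simp
  have "poly g x = 0" if "x \<noteq> 0" for x
  proof -
    have "(x ^ k + 1) * poly g x = 0"
      using arg_cong [OF fac, of "\<lambda>p. poly p x"] field_power_card_minus_1 [OF that]
      by (simp add: poly_X poly_monom)
    moreover have "x ^ k + 1 \<noteq> 0"
      using no_root that by (auto simp: eq_neg_iff_add_eq_0)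
    ultimately show ?thesis
      by simp
  qed
  then have "card (UNIV - {0::'a}) \<le> card {x. poly g x = 0}"
    by (intro card_mono) auto
  also have "\<dots> \<le> Polynomial.degree g"
    by (rule card_poly_roots_bound [OF nz(2)])
  finally show False
    using deg_g \<open>0 < k\<close> by simp
qed

lemma power_set_mult:
  assumes "x \<in> power_set k" "y \<in> power_set k"
  shows "x * y \<in> power_set k"
  using assms unfolding power_set_def by (force simp: power_mult_distrib [symmetric])

text \<open>The set contains \<open>1\<close> and is closed under products, so it is stable under
  negation as soon as it contains \<open>- 1\<close>.\<close>

lemma gp_undirected_iff_minus_one:
  "gp_undirected TYPE('a::field) k \<longleftrightarrow> (- 1 :: 'a) \<in> power_set k"
proof
  assume "gp_undirected TYPE('a) k"
  moreover have "(1::'a) \<in> power_set k"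
    unfolding power_set_def by (rule image_eqI[of _ _ 1]) auto
  ultimately show "(- 1 :: 'a) \<in> power_set k"
    unfolding gp_undirected_def by blast
next
  assume m1: "(- 1 :: 'a) \<in> power_set k"
  have neg: "- x \<in> power_set k" if "x \<in> power_set k" for x :: 'a
    using power_set_mult [OF m1 that] by simp
  have "x \<in> uminus ` power_set k" if "x \<in> power_set k" for x :: 'a
    using neg [OF that] by (intro image_eqI[of _ _ "- x"]) auto
  with neg show "gp_undirected TYPE('a) k"
    unfolding gp_undirected_def by blast
qed

text \<open>Raising \<open>x ^ k = - 1\<close> to the power \<open>(q - 1) / k\<close> gives
  \<open>1\<close>, which forces that exponent to be even. Conversely, an even quotient means that
  \<open>2 * k\<close> divides \<open>q - 1\<close>.\<close>

lemma gp_undirected_iff_even_quotient: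
  assumes "0 < k" "k dvd CARD('a) - 1" "(1 :: 'a::{field,finite}) \<noteq> - 1"
  shows "gp_undirected TYPE('a) k \<longleftrightarrow> even ((CARD('a) - 1) div k)"
proof
  assume "gp_undirected TYPE('a) k"
  then obtain x :: 'a where x: "x \<noteq> 0" "x ^ k = - 1"
    unfolding gp_undirected_iff_minus_one power_set_def by force
  have "(- 1 :: 'a) ^ ((CARD('a) - 1) div k) = x ^ (CARD('a) - 1)"
    using assms(2) by (simp add: flip: x(2) power_mult)
  then show "even ((CARD('a) - 1) div k)"
    using field_power_card_minus_1 [OF x(1)] assms(3)
    by (metis power_minus_odd power_one)
next
  assume "even ((CARD('a) - 1) div k)"
  then have "2 * k dvd CARD('a) - 1"
    using assms by (metis dvd_div_mult_self dvd_refl mult_dvd_mono)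
  from minus_one_is_power [OF assms(1) this]
  show "gp_undirected TYPE('a) k"
    unfolding gp_undirected_iff_minus_one power_set_def by force
qed

lemma power_set_half:
  assumes "2 * h dvd CARD('a) - 1" "odd ((CARD('a) - 1) div (2 * h))" "0 < h"
  shows "(power_set h :: 'a::{field,finite} set) =
    power_set (2 * h) \<union> uminus ` power_set (2 * h)"
proof (intro equalityI subsetI)
  fix y :: 'a
  assume "y \<in> power_set h"
  then obtain x where x: "x \<noteq> 0" "y = x ^ h"
    unfolding power_set_def by blast
  obtain j where j: "CARD('a) - 1 = 2 * h * (2 * j + 1)"
    using assms by (metis dvd_mult_div_cancel oddE)
  \<comment> \<open>Chosen so that \<open>z ^ (2 * h)\<close> is the inverse of
    \<open>y ^ (2 * j)\<close>. Then \<open>y\<close> is \<open>y ^ (2 * j + 1)\<close>, a square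
    root of \<open>1\<close>, times a \<open>2 * h\<close>-th power.\<close>
  define z where "z = inverse x ^ j"
  have z: "z \<noteq> 0"
    using x by (simp add: z_def)
  have "(y ^ (2 * j + 1))\<^sup>2 = 1"
    using field_power_card_minus_1 [OF x(1)]
    unfolding j x(2) by (simp only: flip: power_mult) (simp add: algebra_simps)
  then have "y ^ (2 * j + 1) = 1 \<or> y ^ (2 * j + 1) = - 1"
    by (simp add: power2_eq_1_iff)
  moreover have "y = y ^ (2 * j + 1) * z ^ (2 * h)"
  proof -
    have "x ^ (h * (2 * j)) * z ^ (2 * h) = 1"
      using x(1) by (simp add: z_def power_inverse mult_ac flip: power_mult)
    then show ?thesis
      by (simp add: x(2) power_add flip: power_mult)
  qed
  ultimately have "y = z ^ (2 * h) \<or> y = - (z ^ (2 * h))"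
    by (metis mult_1 mult_minus1)
  then show "y \<in> power_set (2 * h) \<union> uminus ` power_set (2 * h)"
    using z unfolding power_set_def by blast
next
  fix y :: 'a
  assume "y \<in> power_set (2 * h) \<union> uminus ` power_set (2 * h)"
  then obtain x where x: "x \<noteq> 0" "y = x ^ (2 * h) \<or> y = - (x ^ (2 * h))"
    unfolding power_set_def by blast
  have "x ^ (2 * h) \<in> power_set h"
    unfolding power_set_def using x(1)
    by (intro image_eqI[of _ _ "x\<^sup>2"]) (auto simp: power_mult)
  moreover have "(- 1 :: 'a) \<in> power_set h"
    using minus_one_is_power [OF assms(3,1)] unfolding power_set_def by force
  ultimately show "y \<in> power_set h"
    using x(2) power_set_mult [of "- 1" h "x ^ (2 * h)"] by auto
qed

section \<open>Additive characters\<close>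

lemma CHAR_eq_prime:
  assumes "prime p" "CARD('a::{field,finite}) = p ^ m"
  shows "CHAR('a) = p"
proof -
  have "prime (CHAR('a))"
    using finite_imp_CHAR_pos [where 'a = 'a] by (intro prime_CHAR_semidom) auto
  moreover have "CHAR('a) dvd p ^ m"
    using CHAR_dvd_CARD [where 'a = 'a] assms(2) by simp
  ultimately show ?thesis
    using assms(1) by (metis prime_dvd_power primes_dvd_imp_eq)
qed

text \<open>With \<open>p\<close> the characteristic, the images of \<open>0, ..., p - 1\<close> are
  \<open>p\<close> distinct roots of \<open>X ^ p - X\<close>, which has at most \<open>p\<close>
  roots.\<close>

lemma prime_subfield_eq:
  assumes "prime CHAR('a)"
  shows "{y :: 'a::{field,finite}. y ^ CHAR('a) = y} = of_nat ` {..<CHAR('a)}"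
proof -
  let ?p = "CHAR('a)"
  define f where "f = Polynomial.monom (1::'a) ?p - Polynomial.monom 1 1"
  have gt1: "?p > 1"
    using assms by (rule prime_gt_1_nat)
  have deg: "Polynomial.degree f = ?p"
    unfolding f_def using gt1 unfolding diff_conv_add_uminus by (subst degree_add_eq_left) (auto simp: degree_monom_eq)
  then have "f \<noteq> 0"
    using gt1 by auto
  have eq: "{y. y ^ ?p = y} = {y. poly f y = 0}"
    by (simp add: f_def poly_monom)
  \<comment> \<open>The freshman's dream applied to a sum of \<open>n\<close> ones.\<close>
  have "of_nat n ^ ?p = (of_nat n :: 'a)" for n
    using freshmans_dream_sum [OF assms refl, of "\<lambda>_. 1 :: 'a" "{..<n}"] by simp
  then have "of_nat ` {..<?p} \<subseteq> {y :: 'a. y ^ ?p = y}"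
    by auto
  moreover have "card {y :: 'a. y ^ ?p = y} \<le> card (of_nat ` {..<?p} :: 'a set)"
  proof -
    have "inj_on (of_nat :: nat \<Rightarrow> 'a) {..<?p}"
      by (auto intro!: inj_onI simp: of_nat_eq_iff_cong_CHAR cong_def)
    then show ?thesis
      using card_poly_roots_bound [OF \<open>f \<noteq> 0\<close>] by (simp add: eq deg card_image)
  qed
  ultimately show ?thesis
    by (intro card_seteq [symmetric]) auto
qed

text \<open>Norm 1 excludes zero values and turns inverses into conjugates.\<close>

definition nontrivial_character :: "('a::field \<Rightarrow> complex) \<Rightarrow> bool" where
  "nontrivial_character \<psi> \<longleftrightarrow>
    (\<forall>x y. \<psi> (x + y) = \<psi> x * \<psi> y) \<and> (\<forall>x. norm (\<psi> x) = 1) \<and> (\<exists>x. \<psi> x \<noteq> 1)"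

text \<open>
  The character is \<open>x \<mapsto> exp (2 \<pi> \<i> Tr(x) / p)\<close>, where \<open>Tr(x) = \<Sum>i<m. x ^ (p ^ i)\<close> is the trace to
  the prime field.
\<close>

lemma ex_nontrivial_character:
  assumes "prime p" "CARD('a::{field,finite}) = p ^ m" "0 < m"
  shows "\<exists>\<psi> :: 'a \<Rightarrow> complex. nontrivial_character \<psi>"
proof -
  have char: "CHAR('a) = p"
    using CHAR_eq_prime assms(1,2) by blast
  have gt1: "p > 1"
    using assms(1) by (rule prime_gt_1_nat)
  have pow_q: "x ^ (p ^ m) = x" for x :: 'a
  proof (cases "x = 0")
    case False
    have "p ^ m = Suc (p ^ m - 1)"
      using gt1 by simp
    then have "x ^ (p ^ m) = x * x ^ (p ^ m - 1)"
      by (metis power_Suc)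
    then show ?thesis
      using field_power_card_minus_1 [OF False] assms(2) by simp
  qed (use gt1 in auto)
  define Tr :: "'a \<Rightarrow> 'a" where "Tr x = (\<Sum>i<m. x ^ (p ^ i))" for x
  have Tr_add: "Tr (x + y) = Tr x + Tr y" for x y
  proof -
    have "(x + y) ^ (p ^ i) = x ^ (p ^ i) + y ^ (p ^ i)" for i
      by (rule freshmans_dream') (simp_all add: char assms(1))
    then show ?thesis
      by (simp add: Tr_def sum.distrib)
  qed
  \<comment> \<open>Frobenius permutes the summands of the trace cyclically, because
    \<open>x ^ (p ^ m) = x\<close> closes the cycle. Hence the trace is fixed by Frobenius and lies
    in the prime field.\<close>
  have Tr_prime: "\<exists>n. of_nat n = Tr x" for x
  proof -
    have "Tr x ^ p = (\<Sum>i<m. x ^ (p ^ Suc i))"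
      unfolding Tr_def using char assms(1)
      by (subst freshmans_dream_sum) (simp_all add: mult.commute flip: power_mult)
    also have "\<dots> = Tr x"
    proof -
      have "(\<Sum>i<m. x ^ (p ^ Suc i)) + x ^ (p ^ 0) = (\<Sum>i<Suc m. x ^ (p ^ i))"
        by (subst sum.lessThan_Suc_shift) (simp add: add.commute)
      also have "\<dots> = Tr x + x ^ (p ^ m)"
        by (simp add: Tr_def)
      finally show ?thesis
        by (simp add: pow_q)
    qed
    finally have "Tr x \<in> of_nat ` {..<p}"
      using prime_subfield_eq [where 'a = 'a] char assms(1) by blast
    then show ?thesis
      by auto
  qed
  have Tr_nz: "\<exists>x. Tr x \<noteq> 0"
  proof (rule ccontr)
    assume zero: "\<not> ?thesis"
    \<comment> \<open>The trace as a polynomial: its linear coefficient is 1 and its degree is below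
      \<open>q\<close>, so it cannot vanish on the whole field.\<close>
    define f where "f = (\<Sum>i<m. Polynomial.monom (1::'a) (p ^ i))"
    have "poly f x = Tr x" for x
      by (simp add: f_def Tr_def poly_sum poly_monom)
    then have roots: "{x. poly f x = 0} = UNIV"
      using zero by auto
    have "Polynomial.coeff f 1 = (\<Sum>i<m. if i = 0 then 1 else 0)"
      unfolding f_def Polynomial.coeff_sum using gt1 by (intro sum.cong) (auto simp: Polynomial.coeff_monom)
    then have "f \<noteq> 0"
      using assms(3) by auto
    have "Polynomial.degree f \<le> p ^ (m - 1)"
      unfolding f_def using gt1
      by (intro degree_sum_le) (auto simp: degree_monom_eq intro!: power_increasing)
    also have "\<dots> < p ^ m"
      using gt1 assms(3) by (intro power_strict_increasing) auto
    finally show False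
      using card_poly_roots_bound [OF \<open>f \<noteq> 0\<close>] roots assms(2) by simp
  qed
  \<comment> \<open>An arbitrary natural number representing the trace. The choice is harmless,
    since \<open>e\<close> depends only on the residue modulo \<open>p\<close>.\<close>
  define t where "t x = (SOME n. of_nat n = Tr x)" for x
  have t: "of_nat (t x) = Tr x" for x
    unfolding t_def using Tr_prime by (rule someI_ex)
  define e :: "nat \<Rightarrow> complex" where "e n = exp (2 * of_real pi * \<i> * of_nat n / of_nat p)" for n
  have e_add: "e (a + b) = e a * e b" for a b
    by (simp add: e_def add_divide_distrib ring_distribs exp_add)
  have e_eq: "e a = e b \<longleftrightarrow> (of_nat a :: 'a) = of_nat b" for a b
    unfolding e_def using gt1
    by (subst complex_root_unity_eq) (auto simp: of_nat_eq_iff_cong_CHAR char cong_def)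
  have "nontrivial_character (\<lambda>x. e (t x))"
    unfolding nontrivial_character_def
  proof (intro conjI allI)
    show "e (t (x + y)) = e (t x) * e (t y)" for x y
      by (simp add: e_eq t Tr_add flip: e_add)
    show "norm (e (t x)) = 1" for x
      by (simp add: e_def norm_exp_eq_Re)
    obtain x where "Tr x \<noteq> 0"
      using Tr_nz by blast
    then have "e (t x) \<noteq> e 0"
      by (simp add: e_eq t)
    then show "\<exists>x. e (t x) \<noteq> 1"
      by (auto simp: e_def)
  qed
  then show ?thesis
    by blast
qed

context
  fixes \<psi> :: "'a::{field,finite} \<Rightarrow> complex"
  assumes \<psi>: "nontrivial_character \<psi>"
begin

lemma character_add: "\<psi> (x + y) = \<psi> x * \<psi> y"
  using \<psi> by (simp add: nontrivial_character_def)

lemma character_0: "\<psi> 0 = 1"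
proof -
  have "\<psi> 0 \<noteq> 0"
    using \<psi> unfolding nontrivial_character_def by (metis norm_zero zero_neq_one)
  then show ?thesis
    using character_add [of 0 0] by simp
qed

lemma character_minus: "\<psi> (- x) = cnj (\<psi> x)"
proof -
  have "norm (\<psi> x) = 1"
    using \<psi> by (simp add: nontrivial_character_def)
  then have "\<psi> x * cnj (\<psi> x) = 1"
    by (simp add: complex_norm_square [symmetric])
  moreover have "\<psi> x * \<psi> (- x) = 1"
    by (simp add: character_0 flip: character_add)
  ultimately show ?thesis
    by (metis mult_cancel_left mult_zero_left zero_neq_one)
qed

text \<open>Orthogonality of characters: for nonzero \<open>a\<close>, rescaling reduces to
  \<open>a = 1\<close>, and shifting by \<open>b\<close> multiplies that sum by
  \<open>\<psi> b\<close>, which differs from 1.\<close>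

lemma sum_character_mult: "(\<Sum>x\<in>UNIV. \<psi> (a * x)) = (if a = 0 then of_nat CARD('a) else 0)"
proof (cases "a = 0")
  case False
  obtain b where b: "\<psi> b \<noteq> 1"
    using \<psi> by (auto simp: nontrivial_character_def)
  have "(\<Sum>x\<in>UNIV. \<psi> (a * x)) = (\<Sum>x\<in>UNIV. \<psi> x)"
    by (rule sum.reindex_bij_witness[of _ "\<lambda>x. x / a" "\<lambda>x. a * x"]) (use False in auto)
  moreover have "(\<Sum>x\<in>UNIV. \<psi> x) = (\<Sum>x\<in>UNIV. \<psi> (b + x))"
    by (rule sum.reindex_bij_witness[of _ "\<lambda>x. b + x" "\<lambda>x. x - b"]) auto
  then have "(1 - \<psi> b) * (\<Sum>x\<in>UNIV. \<psi> x) = 0"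
    by (simp add: character_add left_diff_distrib flip: sum_distrib_left)
  ultimately show ?thesis
    using b False by simp
qed (simp add: character_0)

end

section \<open>Spectra of Cayley digraphs\<close>

unbundle no Formal_Power_Series.fps_syntax

text \<open>The columns of \<open>V\<close> are eigenvectors, so \<open>A V = V diag(d)\<close>.
  Lifting to polynomial matrices and cancelling \<open>det V\<close> gives the result. The scalar
  \<open>c\<close> allows an unnormalised inverse, so no division is involved.\<close>

lemma charpoly_eq_prod_eigenvalues:
  fixes A V W :: "'a::idom ^ 'n ^ 'n"
  assumes eigen: "\<And>i j. (A ** V) $ i $ j = V $ i $ j * d j"
    and inv: "V ** W = mat c" "c \<noteq> 0"
  shows "charpoly A = (\<Prod>j\<in>UNIV. [:- d j, 1:])"
proof -
  \<comment> \<open>\<open>C\<close> views a matrix as one with constant polynomial entries, and it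
    respects products.\<close>
  define C where "C M = (\<chi> i j. [:M $ i $ j:])" for M :: "'a ^ 'n ^ 'n"
  define D where "D = (\<chi> i j. if i = j then [:- d j, 1:] else 0)"
  have pC: "(\<Sum>i\<in>S. [:g i:]) = [:\<Sum>i\<in>S. g i:]" for S :: "'n set" and g :: "'n \<Rightarrow> 'a"
    by (induction S rule: infinite_finite_induct) auto
  have C_mult: "C M ** C N = C (M ** N)" for M N
    by (simp add: C_def matrix_matrix_mult_def vec_eq_iff pC mult.commute)
  have "C (mat c) = mat [:c:]"
    by (simp add: C_def mat_def vec_eq_iff)
  then have "det (C V) * det (C W) = det (mat [:c:] :: 'a poly ^ 'n ^ 'n)"
    by (simp add: C_mult inv flip: det_mul)
  also have "\<dots> = [:c:] ^ CARD('n)"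
    by (subst det_diagonal) (auto simp: mat_def)
  finally have nz: "det (C V) \<noteq> 0"
    using inv(2) by auto
  have "(mat [:0, 1:] - C A) ** C V = C V ** D"
  proof -
    have "(mat [:0, 1:] ** C V) $ i $ j = [:0, V $ i $ j:]" for i j
      by (simp add: mat_def C_def matrix_matrix_mult_def if_distrib [where f = "Polynomial.smult c" for c]
          sum.delta cong: if_cong)
    moreover have "(C A ** C V) $ i $ j = [:V $ i $ j * d j:]" for i j
      by (simp add: C_mult eigen) (simp add: C_def eigen)
    moreover have "(C V ** D) $ i $ j = [:V $ i $ j:] * [:- d j, 1:]" for i j
      by (simp add: D_def C_def matrix_matrix_mult_def if_distrib [where f = "Polynomial.smult c" for c]
          sum.delta cong: if_cong)
    moreover have "(M - N) ** P = M ** P - N ** P" for M N P :: "'a poly ^ 'n ^ 'n"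
      by (simp add: vec_eq_iff matrix_matrix_mult_def left_diff_distrib sum_subtractf)
    ultimately show ?thesis
      by (simp add: vec_eq_iff)
  qed
  then have "det (mat [:0, 1:] - C A) * det (C V) = det (C V) * det D"
    by (simp flip: det_mul)
  then have "charpoly A = det D"
    using nz by (simp add: charpoly_def C_def)
  also have "\<dots> = (\<Prod>j\<in>UNIV. [:- d j, 1:])"
    by (subst det_diagonal) (auto simp: D_def)
  finally show ?thesis .
qed

text \<open>\<open>V\<close> is the character table, whose columns are eigenvectors for every
  connection set. \<open>W\<close> is its conjugate transpose, so orthogonality gives
  \<open>V W = q I\<close>.\<close>

lemma Spec_Cayley:
  fixes \<psi> :: "'a::{field,finite} \<Rightarrow> complex" and G :: "'a pair_pre_digraph"
  assumes \<psi>: "nontrivial_character \<psi>" and G: "parcs G = {(x, y). y - x \<in> R}"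
  shows "Spec G = image_mset (\<lambda>a. \<Sum>r\<in>R. \<psi> (a * r)) (mset_set UNIV)"
proof -
  define d where "d a = (\<Sum>r\<in>R. \<psi> (a * r))" for a
  define V where "V = (\<chi> x a. \<psi> (a * x))"
  define W where "W = (\<chi> a x. \<psi> (- (a * x)))"
  have "charpoly (adjacency_matrix G) = (\<Prod>a\<in>UNIV. [:- d a, 1:])"
  proof (rule charpoly_eq_prod_eigenvalues)
    fix x a
    have "(adjacency_matrix G ** V) $ x $ a = (\<Sum>y\<in>UNIV. if y - x \<in> R then \<psi> (a * y) else 0)"
      by (simp add: matrix_matrix_mult_def adjacency_matrix_def G V_def
          if_distrib [where f = "\<lambda>x. x * y" for y] cong: if_cong)
    also have "\<dots> = (\<Sum>y\<in>{y. y - x \<in> R}. \<psi> (a * y))"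
      by (simp add: sum.If_cases)
    \<comment> \<open>Substituting \<open>y = x + r\<close> lets the factor
      \<open>\<psi> (a * x)\<close> be pulled out.\<close>
    also have "\<dots> = (\<Sum>r\<in>R. \<psi> (a * x + a * r))"
      by (rule sum.reindex_bij_witness[of _ "\<lambda>r. x + r" "\<lambda>y. y - x"]) (auto simp: algebra_simps)
    also have "\<dots> = V $ x $ a * d a"
      by (simp add: V_def d_def character_add [OF \<psi>] sum_distrib_left)
    finally show "(adjacency_matrix G ** V) $ x $ a = V $ x $ a * d a" .
  next
    have "(V ** W) $ x $ y = (\<Sum>a\<in>UNIV. \<psi> ((x - y) * a))" for x y
      by (simp add: matrix_matrix_mult_def V_def W_def algebra_simps flip: character_add [OF \<psi>])
    then show "V ** W = mat (of_nat CARD('a))"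
      by (simp add: vec_eq_iff sum_character_mult [OF \<psi>] mat_def)
  qed simp
  then have "Spec G = (\<Sum>a\<in>UNIV. {#d a#})"
    by (simp add: Spec_def proots_prod)
  also have "\<dots> = image_mset d (mset_set UNIV)"
    by (simp add: sum_unfold_sum_mset)
  finally show ?thesis
    by (simp add: d_def [abs_def])
qed

text \<open>Disjointness splits each character sum into a sum over \<open>R\<close> and its
  conjugate. Multiplicities agree because both spectra are indexed by the same
  \<open>a\<close>.\<close>

lemma Spec_symmetric_closure:
  fixes \<psi> :: "'a::{field,finite} \<Rightarrow> complex" and G H :: "'a pair_pre_digraph"
  assumes \<psi>: "nontrivial_character \<psi>"
    and G: "parcs G = {(x, y). y - x \<in> R}"
    and H: "parcs H = {(x, y). y - x \<in> R \<union> uminus ` R}"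
    and disj: "R \<inter> uminus ` R = {}"
  shows "Spec H = image_mset (\<lambda>l. complex_of_real (2 * Re l)) (Spec G)"
proof -
  have "(\<Sum>r\<in>R \<union> uminus ` R. \<psi> (a * r)) = complex_of_real (2 * Re (\<Sum>r\<in>R. \<psi> (a * r)))" for a
  proof -
    have "(\<Sum>r\<in>R \<union> uminus ` R. \<psi> (a * r)) = (\<Sum>r\<in>R. \<psi> (a * r)) + (\<Sum>r\<in>uminus ` R. \<psi> (a * r))"
      using disj by (intro sum.union_disjoint) auto
    also have "(\<Sum>r\<in>uminus ` R. \<psi> (a * r)) = cnj (\<Sum>r\<in>R. \<psi> (a * r))"
      by (simp add: sum.reindex character_minus [OF \<psi>])
    finally show ?thesis
      by (simp only: complex_add_cnj)
  qed
  then show ?thesis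
    by (simp add: Spec_Cayley [OF \<psi> G] Spec_Cayley [OF \<psi> H] multiset.map_comp comp_def)
qed

theorem theorem3p5:
  fixes p m q k :: nat
  assumes "prime p" and "odd p" and "0 < m" and "q = p ^ m"
    and "CARD('a::{field,finite}) = q"
    and "0 < k" and "k dvd q - 1"
  shows "(gp_undirected TYPE('a) k \<longleftrightarrow>
            multiplicity 2 k < multiplicity 2 (q - 1) \<or> multiplicity 2 k = 0) \<and>
         (gp_directed TYPE('a) k \<longleftrightarrow>
            multiplicity 2 k = multiplicity 2 (q - 1) \<and> multiplicity 2 (q - 1) > 0) \<and>
         (gp_directed TYPE('a) k \<longrightarrow>
            even k \<and>
            gp_undirected TYPE('a) (k div 2) \<and>
            parcs (gen_paley (k div 2) :: 'a pair_pre_digraph) =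
              parcs (gen_paley k) \<union> (parcs (gen_paley k))\<inverse> \<and>
            (power_set (k div 2) :: 'a set) = power_set k \<union> uminus ` power_set k \<and>
            (power_set k :: 'a set) \<inter> uminus ` power_set k = {} \<and>
            Spec (gen_paley (k div 2) :: 'a pair_pre_digraph) =
              image_mset (\<lambda>l. complex_of_real (2 * Re l)) (Spec (gen_paley k :: 'a pair_pre_digraph)))"
    (is "?U \<and> ?D \<and> (_ \<longrightarrow> ?C)")
proof -
  note card = \<open>CARD('a) = q\<close>
  have odd_q: "odd q" and q_gt: "q > 1"
    using assms(1-4) prime_gt_1_nat [OF assms(1)] one_less_power [of p m] by simp_all
  have char: "CHAR('a) = p"
    using CHAR_eq_prime assms(1,4,5) by blast
  have one_neq: "(1 :: 'a) \<noteq> - 1"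
  proof
    assume "(1 :: 'a) = - 1"
    then have "(of_nat 2 :: 'a) = 0"
      by (simp add: eq_neg_iff_add_eq_0)
    then have "p dvd 2"
      using char by (simp only: of_nat_eq_0_iff_char_dvd)
    then show False
      using assms(1,2) by (metis primes_dvd_imp_eq two_is_prime_nat even_numeral)
  qed
  define n where "n = (q - 1) div k"
  have n: "q - 1 = k * n"
    using assms(7) by (simp add: n_def)
  then have "n > 0"
    using q_gt by (cases n) auto
  have und: "gp_undirected TYPE('a) k \<longleftrightarrow> even n"
    using gp_undirected_iff_even_quotient [OF assms(6) _ one_neq] assms(7) by (simp add: card n_def)
  have val: "multiplicity 2 (q - 1) = multiplicity 2 k + multiplicity 2 n"
    unfolding n using \<open>0 < k\<close> \<open>0 < n\<close> by (intro prime_elem_multiplicity_mult_distrib) auto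
  \<comment> \<open>Given this, \<open>multiplicity 2 k = 0\<close> already forces \<open>n\<close>
    to be even, so both valuation criteria reduce to the parity of \<open>n\<close>.\<close>
  have pos: "multiplicity 2 (q - 1) > 0"
    using odd_q q_gt by (simp add: multiplicity_gt_zero_iff)
  have even_n: "even n \<longleftrightarrow> multiplicity 2 n > 0"
    using \<open>0 < n\<close> by (simp add: multiplicity_gt_zero_iff)
  have ?U ?D
    using und val pos even_n by auto
  moreover have ?C if dir: "gp_directed TYPE('a) k"
  proof -
    have "odd n"
      using und dir by blast
    moreover have "even (k * n)"
      using odd_q by (simp flip: n)
    ultimately have "even k"
      by simp
    then obtain h where h: "k = 2 * h"
      by (elim evenE)
    have h0: "0 < h"
      using h \<open>0 < k\<close> by simp
    have half: "(power_set h :: 'a set) = power_set k \<union> uminus ` power_set k"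
      using power_set_half [of h, where 'a = 'a] \<open>odd n\<close> assms(7) h0 by (simp add: h card n_def)
    \<comment> \<open>Here \<open>2 * h = k\<close> divides \<open>q - 1\<close>, so
      \<open>- 1\<close> is an \<open>h\<close>-th power.\<close>
    have "gp_undirected TYPE('a) h"
      using minus_one_is_power [OF h0, where 'a = 'a] assms(7)
      unfolding gp_undirected_iff_minus_one power_set_def card h by force
    moreover have disj: "(power_set k :: 'a set) \<inter> uminus ` power_set k = {}"
    \<comment> \<open>A common element would make \<open>- 1\<close> a quotient of two
      \<open>k\<close>-th powers, hence a \<open>k\<close>-th power.\<close>
    proof (rule ccontr)
      assume "\<not> ?thesis"
      then obtain x y :: 'a where xy: "x \<noteq> 0" "y \<noteq> 0" "x ^ k = - (y ^ k)"
        unfolding power_set_def by blast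
      then have "(x / y) ^ k = - 1"
        by (simp add: power_divide)
      moreover have "(x / y) ^ k \<in> power_set k"
        using xy(1,2) by (simp add: power_set_def)
      ultimately show False
        using dir by (simp add: gp_undirected_iff_minus_one)
    qed
    moreover have "parcs (gen_paley h :: 'a pair_pre_digraph) =
        parcs (gen_paley k) \<union> (parcs (gen_paley k))\<inverse>"
    proof -
      have "d \<in> uminus ` power_set k \<longleftrightarrow> - d \<in> power_set k" for d :: 'a
        by (metis image_iff minus_minus)
      then show ?thesis
        by (auto simp: gen_paley_def half)
    qed
    moreover obtain \<psi> :: "'a \<Rightarrow> complex" where "nontrivial_character \<psi>"
      using ex_nontrivial_character assms(1,3,4,5) by blast
    then have "Spec (gen_paley h :: 'a pair_pre_digraph) =
        image_mset (\<lambda>l. complex_of_real (2 * Re l)) (Spec (gen_paley k :: 'a pair_pre_digraph))"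
      using disj by (intro Spec_symmetric_closure [where R = "power_set k"])
        (simp_all add: gen_paley_def half)
    ultimately show ?thesis
      using \<open>even k\<close> half by (simp add: h)
  qed
  ultimately show ?thesis
    by blast
qed

end
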